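(* Fix an integer $n\ge0$ and a set $N$ with $|N|=n$, and let $w$ mark $x=|X|$. The numbers of $S_X$-orbits of all $n$-families of subsets of $X$ and of $n$-coverings of $X$ are $\binom{2^n+x-1}{x}$ and $\binom{2^n+x-2}{x}$ respectively, and their ordinary generating functions are $$\sum_{x\ge0}\binom{2^n+x-1}{x}w^x=(1-w)^{-2^n},\qquad \sum_{x\ge0}\binom{2^n+x-2}{x}w^x=(1-w)^{-(2^n-1)}.$$
   Context: An $n$-family of subsets of $X$ is a tuple $F=(F_i)_{i\in N}$ with $F_i\subseteq X$; it is an $n$-covering if $\bigcup_{i\in N}F_i=X$. The symmetric group $S_X$ acts by $\sigma\cdot(F_i)_{i\in N}=(\sigma(F_i))_{i\in N}$. Convention: $\binom{-1}{0}=1$. Identities are between formal power series. *)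

theory Defs
  imports
    "HOL-Algebra.Group_Action"
    "HOL-Computational_Algebra.Formal_Power_Series"
begin

definition families :: "'i set \<Rightarrow> 'a set \<Rightarrow> ('i \<Rightarrow> 'a set) set" where
  "families N X = (\<Pi>\<^sub>E i\<in>N. Pow X)"

definition coverings :: "'i set \<Rightarrow> 'a set \<Rightarrow> ('i \<Rightarrow> 'a set) set" where
  "coverings N X = {F \<in> families N X. (\<Union>i\<in>N. F i) = X}"

text \<open>
  The symmetric group of \<open>X\<close> is \<^term>\<open>BijGroup X\<close>. The two restrictions only make the
  functions extensional, as the library's notion of group action requires.
\<close>

definition image_action ::
  "'i set \<Rightarrow> ('i \<Rightarrow> 'a set) set \<Rightarrow> ('a \<Rightarrow> 'a) \<Rightarrow> ('i \<Rightarrow> 'a set) \<Rightarrow> ('i \<Rightarrow> 'a set)" where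
  "image_action N E \<sigma> = (\<lambda>F\<in>E. \<lambda>i\<in>N. \<sigma> ` F i)"

definition num_family_orbits :: "'i set \<Rightarrow> 'a set \<Rightarrow> nat" where
  "num_family_orbits N X =
     card (orbits (BijGroup X) (families N X) (image_action N (families N X)))"

definition num_covering_orbits :: "'i set \<Rightarrow> 'a set \<Rightarrow> nat" where
  "num_covering_orbits N X =
     card (orbits (BijGroup X) (coverings N X) (image_action N (coverings N X)))"

lemma group_action_image_action:
  assumes sub: "E \<subseteq> families N X"
    and closed: "\<And>\<sigma> F. \<sigma> \<in> Bij X \<Longrightarrow> F \<in> E \<Longrightarrow> (\<lambda>i\<in>N. \<sigma> ` F i) \<in> E"
  shows "group_action (BijGroup X) E (image_action N E)"
proof -
  have ext: "F \<in> extensional N" and FX: "\<And>i. i \<in> N \<Longrightarrow> F i \<subseteq> X" if "F \<in> E" for F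
    using sub that by (auto simp: families_def PiE_def)
  have comp: "image_action N E (compose X \<sigma> \<tau>) =
      compose E (image_action N E \<sigma>) (image_action N E \<tau>)"
    if "\<sigma> \<in> Bij X" "\<tau> \<in> Bij X" for \<sigma> \<tau>
  proof
    fix F
    show "image_action N E (compose X \<sigma> \<tau>) F =
      compose E (image_action N E \<sigma>) (image_action N E \<tau>) F"
    proof (cases "F \<in> E")
      case True
      have "compose X \<sigma> \<tau> ` F i = \<sigma> ` \<tau> ` F i" if "i \<in> N" for i
        using FX[OF True that] by (force simp: compose_def image_image)
      then show ?thesis
        using True closed[OF that(2) True]
        by (simp add: image_action_def compose_def cong: restrict_cong)
    qed (simp add: image_action_def compose_def)
  qed
  have one: "image_action N E (\<lambda>x\<in>X. x) = (\<lambda>F\<in>E. F)"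
  proof
    fix F
    show "image_action N E (\<lambda>x\<in>X. x) F = (\<lambda>F\<in>E. F) F"
    proof (cases "F \<in> E")
      case True
      have "(\<lambda>x\<in>X. x) ` F i = F i" if "i \<in> N" for i
        using FX[OF True that] by force
      then have "(\<lambda>i\<in>N. (\<lambda>x\<in>X. x) ` F i) = (\<lambda>i\<in>N. F i)"
        by (simp cong: restrict_cong)
      then show ?thesis
        using True extensional_restrict[OF ext[OF True]] by (simp add: image_action_def)
    qed (simp add: image_action_def)
  qed
  have bij: "image_action N E \<sigma> \<in> Bij E" if s: "\<sigma> \<in> Bij X" for \<sigma>
  proof -
    define \<tau> where "\<tau> = (\<lambda>x\<in>X. inv_into X \<sigma> x)"
    have t: "\<tau> \<in> Bij X"
      unfolding \<tau>_def by (rule restrict_inv_into_Bij[OF s])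
    have id: "compose X \<sigma> \<tau> = (\<lambda>x\<in>X. x)" "compose X \<tau> \<sigma> = (\<lambda>x\<in>X. x)"
      using s Bij_compose_restrict_eq[OF s] compose_id_inv_into[of \<sigma> X X]
      by (simp_all add: \<tau>_def Bij_def bij_betw_def)
    have *: "compose E (image_action N E \<sigma>) (image_action N E \<tau>) = (\<lambda>F\<in>E. F)"
      "compose E (image_action N E \<tau>) (image_action N E \<sigma>) = (\<lambda>F\<in>E. F)"
      using comp[OF s t] comp[OF t s] unfolding id one by simp_all
    have "bij_betw (image_action N E \<sigma>) E E"
    proof (rule bij_betw_byWitness[where f' = "image_action N E \<tau>"])
      show "\<forall>F\<in>E. image_action N E \<tau> (image_action N E \<sigma> F) = F"
        using fun_cong[OF *(2)] by (metis compose_eq restrict_apply')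
      show "\<forall>F\<in>E. image_action N E \<sigma> (image_action N E \<tau> F) = F"
        using fun_cong[OF *(1)] by (metis compose_eq restrict_apply')
    qed (use closed s t in \<open>auto simp: image_action_def\<close>)
    then show ?thesis
      by (simp add: Bij_def image_action_def)
  qed
  have "image_action N E \<in> hom (BijGroup X) (BijGroup E)"
    using comp bij by (auto simp: hom_def BijGroup_def)
  then show ?thesis
    by (simp add: group_action_def group_hom_def group_hom_axioms_def group_BijGroup)
qed

lemma Bij_image_subset: "\<sigma> \<in> Bij X \<Longrightarrow> A \<subseteq> X \<Longrightarrow> \<sigma> ` A \<subseteq> X"
  using Bij_imp_funcset by blast

lemma group_action_families:
  "group_action (BijGroup X) (families N X) (image_action N (families N X))"
proof (rule group_action_image_action)
  fix \<sigma> F assume "\<sigma> \<in> Bij X" "F \<in> families N X"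
  then show "(\<lambda>i\<in>N. \<sigma> ` F i) \<in> families N X"
    using Bij_image_subset[of \<sigma> X] by (simp add: families_def PiE_iff)
qed simp

lemma group_action_coverings:
  "group_action (BijGroup X) (coverings N X) (image_action N (coverings N X))"
proof (rule group_action_image_action)
  show "coverings N X \<subseteq> families N X"
    by (auto simp: coverings_def)
next
  fix \<sigma> F assume s: "\<sigma> \<in> Bij X" and F: "F \<in> coverings N X"
  have "(\<lambda>i\<in>N. \<sigma> ` F i) \<in> families N X"
    using s F Bij_image_subset[of \<sigma> X] by (simp add: coverings_def families_def PiE_iff)
  moreover have "(\<Union>i\<in>N. \<sigma> ` F i) = X"
  proof -
    have "(\<Union>i\<in>N. \<sigma> ` F i) = \<sigma> ` (\<Union>i\<in>N. F i)" by blast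
    also have "\<dots> = X" using s F by (simp add: coverings_def Bij_def bij_betw_def)
    finally show ?thesis .
  qed
  ultimately show "(\<lambda>i\<in>N. \<sigma> ` F i) \<in> coverings N X"
    by (simp add: coverings_def)
qed

end

theory Submission
  imports Defs "HOL-Combinatorics.Permutations"
begin

text \<open>
  A family \<open>F\<close> of subsets of \<open>X\<close> indexed by \<open>N\<close> is the same thing as an incidence relation
  between \<open>N\<close> and \<open>X\<close>, and can be read off from the side of \<open>X\<close>: every point \<open>a\<close> has a
  \<^emph>\<open>profile\<close>, the set of those indices \<open>i\<close> with \<open>a \<in> F i\<close>. So \<open>F\<close> is a colouring of the points of
  \<open>X\<close> by the \<open>2 ^ n\<close> subsets of \<open>N\<close>, and \<open>F\<close> covers \<open>X\<close> exactly when the colour \<open>{}\<close> does not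
  occur, which leaves \<open>2 ^ n - 1\<close> colours.

  A permutation of \<open>X\<close> moves the colours around, and two colourings of a finite set differ by a
  permutation iff they use each colour equally often (lemma \<open>mem_orbit_iff\<close>). An orbit therefore is
  a multiset of \<open>x\<close> colours, and every multiset of \<open>x\<close> colours arises
  (lemma \<open>profile_mset_image\<close>). From \<open>k\<close> colours one can form \<open>k + x - 1\<close> choose \<open>x\<close> such multisets;
  with \<open>k = 2 ^ n\<close> and \<open>k = 2 ^ n - 1\<close> this gives the two counts. The generating functions are then
  the negative binomial series (lemma \<open>negative_binomial_series\<close>).
\<close>

section \<open>Families as colourings\<close>

definition profile :: "'i set \<Rightarrow> ('i \<Rightarrow> 'a set) \<Rightarrow> 'a \<Rightarrow> 'i set" where
  "profile N F a = {i \<in> N. a \<in> F i}"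

definition profile_mset :: "'i set \<Rightarrow> 'a set \<Rightarrow> ('i \<Rightarrow> 'a set) \<Rightarrow> 'i set multiset" where
  "profile_mset N X F = image_mset (profile N F) (mset_set X)"

text \<open>
  Restricting the admissible profiles to \<open>A\<close> treats all families and coverings uniformly.
\<close>

definition families_with_profiles ::
    "'i set \<Rightarrow> 'a set \<Rightarrow> 'i set set \<Rightarrow> ('i \<Rightarrow> 'a set) set" where
  "families_with_profiles N X A = {F \<in> families N X. \<forall>a\<in>X. profile N F a \<in> A}"

lemma families_eq_families_with_profiles:
  "families N X = families_with_profiles N X (Pow N)"
  by (auto simp: families_with_profiles_def profile_def)

lemma coverings_eq_families_with_profiles:
  "coverings N X = families_with_profiles N X (Pow N - {{}})"
proof -
  have "(\<Union>i\<in>N. F i) = X \<longleftrightarrow> (\<forall>a\<in>X. profile N F a \<in> Pow N - {{}})"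
    if "F \<in> families N X" for F
    using that by (auto simp: families_def profile_def PiE_iff)
  then show ?thesis
    unfolding coverings_def families_with_profiles_def by (intro Collect_cong conj_cong refl)
qed

lemma profile_image:
  assumes "inj_on \<sigma> X" "F \<in> families N X" "a \<in> X"
  shows "profile N (\<lambda>i\<in>N. \<sigma> ` F i) (\<sigma> a) = profile N F a"
proof -
  have "\<sigma> a \<in> \<sigma> ` F i \<longleftrightarrow> a \<in> F i" if "i \<in> N" for i
    using assms that by (intro inj_on_image_mem_iff) (auto simp: families_def PiE_iff)
  then show ?thesis
    by (auto simp: profile_def)
qed

lemma families_eqI:
  assumes "F \<in> families N X" "G \<in> families N X"
    and "\<And>a. a \<in> X \<Longrightarrow> profile N F a = profile N G a"
  shows "F = G"
proof
  fix i
  show "F i = G i"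
  proof (cases "i \<in> N")
    case True
    then have "F i \<subseteq> X" "G i \<subseteq> X"
      using assms(1,2) by (auto simp: families_def PiE_iff)
    moreover have "a \<in> F i \<longleftrightarrow> a \<in> G i" if "a \<in> X" for a
      using assms(3)[OF that] True by (auto simp: profile_def)
    ultimately show ?thesis
      by blast
  next
    case False
    then show ?thesis
      using assms(1,2) by (auto simp: families_def PiE_iff extensional_def)
  qed
qed

section \<open>The multiset of profiles classifies orbits\<close>

text \<open>
  Moving \<open>F\<close> by \<open>\<sigma>\<close> only reorders the profiles. Conversely, equal multisets of profiles provide a
  permutation that matches the points of \<open>X\<close> profile by profile, and a family is determined by
  its profiles.
\<close>

lemma mem_orbit_iff:
  assumes fin: "finite X" and sub: "E \<subseteq> families N X" and FG: "F \<in> E" "G \<in> E"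
  shows "G \<in> orbit (BijGroup X) (image_action N E) F \<longleftrightarrow>
         profile_mset N X F = profile_mset N X G"
proof
  assume "G \<in> orbit (BijGroup X) (image_action N E) F"
  then obtain \<sigma> where \<sigma>: "bij_betw \<sigma> X X" and G: "G = (\<lambda>i\<in>N. \<sigma> ` F i)"
    using FG by (auto simp: orbit_def BijGroup_def Bij_def image_action_def)
  from \<sigma> have inj: "inj_on \<sigma> X" and img: "\<sigma> ` X = X"
    by (auto simp: bij_betw_def)
  have "profile_mset N X G = image_mset (profile N G) (image_mset \<sigma> (mset_set X))"
    using image_mset_mset_set[OF inj] img by (simp add: profile_mset_def)
  also have "\<dots> = image_mset (\<lambda>a. profile N G (\<sigma> a)) (mset_set X)"
    by (simp add: multiset.map_comp comp_def)
  also have "\<dots> = profile_mset N X F"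
    unfolding profile_mset_def G
    using profile_image[OF inj] FG sub fin by (intro image_mset_cong) auto
  finally show "profile_mset N X F = profile_mset N X G" ..
next
  assume "profile_mset N X F = profile_mset N X G"
  then obtain p where p: "p permutes X" "\<forall>a\<in>X. profile N F a = profile N G (p a)"
    using image_mset_eq_implies_permutes[OF fin] unfolding profile_mset_def by metis
  define \<sigma> where "\<sigma> = restrict p X"
  have bij: "bij_betw \<sigma> X X"
    using permutes_imp_bij[OF p(1)] by (simp add: \<sigma>_def cong: bij_betw_cong)
  then have \<sigma>: "\<sigma> \<in> Bij X" and inj: "inj_on \<sigma> X" and img: "\<sigma> ` X = X"
    by (auto simp: Bij_def \<sigma>_def bij_betw_def)
  have F: "F \<in> families N X" and G: "G \<in> families N X"
    using FG sub by auto
  have "(\<lambda>i\<in>N. \<sigma> ` F i) = G"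
  proof (rule families_eqI)
    show "(\<lambda>i\<in>N. \<sigma> ` F i) \<in> families N X"
      using F Bij_image_subset[OF \<sigma>] by (simp add: families_def PiE_iff)
    fix b assume "b \<in> X"
    then obtain a where a: "a \<in> X" "b = \<sigma> a"
      using img by blast
    then show "profile N (\<lambda>i\<in>N. \<sigma> ` F i) b = profile N G b"
      using profile_image[OF inj F] p(2) by (simp add: \<sigma>_def)
  qed (rule G)
  then show "G \<in> orbit (BijGroup X) (image_action N E) F"
    using \<sigma> FG by (auto simp: orbit_def BijGroup_def image_action_def)
qed

text \<open>
  A classifying invariant turns orbits into values: the orbits are in bijection with the image of
  any map whose fibres in \<open>E\<close> are exactly the orbits.
\<close>

lemma (in group_action) card_orbits_eq_card_image:
  assumes inv: "\<And>x y. x \<in> E \<Longrightarrow> y \<in> E \<Longrightarrow> y \<in> orbit G \<phi> x \<longleftrightarrow> f x = f y"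
  shows "card (orbits G E \<phi>) = card (f ` E)"
proof -
  have orb: "orbit G \<phi> x = {y \<in> E. f y = f x}" if "x \<in> E" for x
    using inv[OF that] element_image[OF _ that] unfolding orbit_def by force
  have "orbits G E \<phi> = (\<lambda>v. {y \<in> E. f y = v}) ` f ` E"
    using orb unfolding orbits_def by auto
  moreover have "inj_on (\<lambda>v. {y \<in> E. f y = v}) (f ` E)"
    by (auto simp: inj_on_def)
  ultimately show ?thesis
    by (simp add: card_image)
qed

lemma ex_image_mset_mset_set:
  assumes "finite X" "size M = card X"
  shows "\<exists>f. image_mset f (mset_set X) = M"
proof -
  obtain xs where xs: "mset xs = M"
    using ex_mset by blast
  obtain h where h: "bij_betw h X {0..<card X}"
    using ex_bij_betw_finite_nat[OF assms(1)] by blast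
  have len: "length xs = card X"
    using xs assms(2) by auto
  have "image_mset (\<lambda>a. xs ! h a) (mset_set X) = image_mset ((!) xs) (image_mset h (mset_set X))"
    by (simp add: multiset.map_comp comp_def)
  also have "image_mset h (mset_set X) = mset [0..<length xs]"
    using h len by (simp add: image_mset_mset_set bij_betw_def)
  also have "image_mset ((!) xs) (mset [0..<length xs]) = M"
    using xs by (metis map_nth mset_map)
  finally show ?thesis
    by blast
qed

text \<open>
  Every multiset of admissible profiles occurs: distribute its elements over the points of \<open>X\<close> by
  some \<open>f\<close> and let \<open>F i\<close> consist of the points whose assigned profile contains \<open>i\<close>. The profiles of
  this \<open>F\<close> are the values of \<open>f\<close> because these are subsets of \<open>N\<close>.
\<close>

lemma profile_mset_image:
  assumes fin: "finite X" and A: "A \<subseteq> Pow N"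
  shows "profile_mset N X ` families_with_profiles N X A = multisets_of_size A (card X)"
proof (intro equalityI subsetI)
  fix M assume "M \<in> profile_mset N X ` families_with_profiles N X A"
  then show "M \<in> multisets_of_size A (card X)"
    using fin by (auto simp: profile_mset_def multisets_of_size_def families_with_profiles_def)
next
  fix M assume M: "M \<in> multisets_of_size A (card X)"
  then obtain f where f: "image_mset f (mset_set X) = M"
    using ex_image_mset_mset_set[OF fin] multisets_of_size_size by blast
  have fA: "f a \<in> A" if "a \<in> X" for a
    using that fin multisets_of_size_subset[OF M] by (auto simp flip: f)
  define F where "F = (\<lambda>i\<in>N. {a \<in> X. i \<in> f a})"
  have prof: "profile N F a = f a" if "a \<in> X" for a
    using fA[OF that] A that by (auto simp: profile_def F_def)
  have "F \<in> families_with_profiles N X A"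
    using prof fA by (auto simp: families_with_profiles_def families_def F_def)
  moreover have "profile_mset N X F = M"
    unfolding profile_mset_def f[symmetric] using prof fin by (intro image_mset_cong) auto
  ultimately show "M \<in> profile_mset N X ` families_with_profiles N X A"
    by blast
qed

lemma card_orbits_families_with_profiles:
  assumes "finite X" "finite N" "A \<subseteq> Pow N" "E = families_with_profiles N X A"
    and act: "group_action (BijGroup X) E (image_action N E)"
  shows "card (orbits (BijGroup X) E (image_action N E)) = (card A + card X - 1) choose card X"
proof -
  have "E \<subseteq> families N X"
    using assms(4) by (auto simp: families_with_profiles_def)
  then have "card (orbits (BijGroup X) E (image_action N E)) = card (profile_mset N X ` E)"
    using assms(1) by (intro group_action.card_orbits_eq_card_image[OF act] mem_orbit_iff) auto
  also have "profile_mset N X ` E = multisets_of_size A (card X)"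
    using assms by (simp add: profile_mset_image)
  also have "card \<dots> = (card A + card X - 1) choose card X"
    using assms finite_subset[of A "Pow N"] by (intro card_multisets_of_size) auto
  finally show ?thesis .
qed

section \<open>Counts and generating functions\<close>

text \<open>
  The natural subtraction truncates only at \<open>k = x = 0\<close>, where it gives \<open>0\<close> instead of \<open>- 1\<close>;
  this does not change the value, since both \<open>0\<close> choose \<open>0\<close> and \<open>- 1\<close> choose \<open>0\<close> are \<open>1\<close>.
\<close>

lemma of_nat_binomial_multiset:
  "(of_nat ((k + x - 1) choose x) :: 'b :: field_char_0) = (of_nat k + of_nat x - 1) gchoose x"
  by (cases "k + x = 0") (auto simp: binomial_gbinomial of_nat_diff)

lemma num_family_orbits_eq:
  assumes "finite X" "finite N"
  shows "(of_nat (num_family_orbits N X) :: 'b :: field_char_0) =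
         (2 ^ card N + of_nat (card X) - 1) gchoose card X"
proof -
  have "num_family_orbits N X = (2 ^ card N + card X - 1) choose card X"
    unfolding num_family_orbits_def
    using card_orbits_families_with_profiles[OF assms subset_refl
        families_eq_families_with_profiles group_action_families]
    by (simp add: card_Pow assms)
  then show ?thesis
    using of_nat_binomial_multiset[of "2 ^ card N" "card X", where 'b = 'b] by simp
qed

lemma num_covering_orbits_eq:
  assumes "finite X" "finite N"
  shows "(of_nat (num_covering_orbits N X) :: 'b :: field_char_0) =
         (2 ^ card N + of_nat (card X) - 2) gchoose card X"
proof -
  have "card (Pow N - {{}}) = 2 ^ card N - 1"
    using assms(2) by (simp add: card_Diff_subset card_Pow)
  then have "num_covering_orbits N X = (2 ^ card N - 1 + card X - 1) choose card X"
    unfolding num_covering_orbits_def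
    using card_orbits_families_with_profiles[OF assms Diff_subset
        coverings_eq_families_with_profiles group_action_coverings]
    by simp
  then show ?thesis
    using of_nat_binomial_multiset[of "2 ^ card N - 1" "card X", where 'b = 'b]
    by (simp add: of_nat_diff algebra_simps)
qed

text \<open>
  This is the binomial series with exponent \<open>- k\<close> at \<open>- fps_X\<close>, since the sign in
  \<open>(- 1) ^ x\<close> turns the coefficient \<open>- k\<close> choose \<open>x\<close> into \<open>k + x - 1\<close> choose \<open>x\<close>.
\<close>

lemma negative_binomial_series:
  "Abs_fps (\<lambda>x. (of_nat k + of_nat x - 1 :: 'b :: field_char_0) gchoose x) =
   (1 - fps_X) powi (- int k)"
proof -
  have "inverse ((1 - fps_X :: 'b fps) ^ k) =
        fps_compose (fps_binomial (- of_nat k)) (fps_const (- 1) * fps_X)"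
    using one_minus_fps_X_const_neg_power[of "1 :: 'b" k] by (simp flip: fps_const_neg)
  also have "\<dots> = Abs_fps (\<lambda>x. (- 1) ^ x * (- of_nat k gchoose x))"
    by (simp only: fps_compose_linear fps_binomial_nth)
  also have "\<dots> = Abs_fps (\<lambda>x. (of_nat k + of_nat x - 1) gchoose x)"
    by (simp add: gbinomial_minus flip: mult.assoc power_mult_distrib)
  finally show ?thesis
    by (cases "k = 0") (simp_all add: power_int_def fps_inverse_power)
qed

theorem theorem13p3:
  fixes n :: nat and N :: "'i set"
  assumes "finite N" and "card N = n"
  shows "(\<forall>(X :: 'a set) x. finite X \<and> card X = x \<longrightarrow>
             (of_nat (num_family_orbits N X) :: rat) = (2 ^ n + of_nat x - 1) gchoose x \<and>
             (of_nat (num_covering_orbits N X) :: rat) = (2 ^ n + of_nat x - 2) gchoose x) \<and>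
         Abs_fps (\<lambda>x. of_nat (num_family_orbits N {..<x}) :: rat) =
           Abs_fps (\<lambda>x. (2 ^ n + of_nat x - 1) gchoose x) \<and>
         Abs_fps (\<lambda>x. (2 ^ n + of_nat x - 1 :: rat) gchoose x) =
           (1 - fps_X) powi (- (2 ^ n)) \<and>
         Abs_fps (\<lambda>x. of_nat (num_covering_orbits N {..<x}) :: rat) =
           Abs_fps (\<lambda>x. (2 ^ n + of_nat x - 2) gchoose x) \<and>
         Abs_fps (\<lambda>x. (2 ^ n + of_nat x - 2 :: rat) gchoose x) =
           (1 - fps_X) powi (- (2 ^ n - 1))"
proof (intro conjI allI impI)
  fix X :: "'a set" and x
  assume "finite X \<and> card X = x"
  then show "(of_nat (num_family_orbits N X) :: rat) = (2 ^ n + of_nat x - 1) gchoose x"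
    and "(of_nat (num_covering_orbits N X) :: rat) = (2 ^ n + of_nat x - 2) gchoose x"
    using num_family_orbits_eq[of X N] num_covering_orbits_eq[of X N] assms by auto
next
  show "Abs_fps (\<lambda>x. of_nat (num_family_orbits N {..<x}) :: rat) =
      Abs_fps (\<lambda>x. (2 ^ n + of_nat x - 1) gchoose x)"
    using num_family_orbits_eq[of "{..<_ :: nat}" N, where 'b = rat] assms by simp
  show "Abs_fps (\<lambda>x. of_nat (num_covering_orbits N {..<x}) :: rat) =
      Abs_fps (\<lambda>x. (2 ^ n + of_nat x - 2) gchoose x)"
    using num_covering_orbits_eq[of "{..<_ :: nat}" N, where 'b = rat] assms by simp
  show "Abs_fps (\<lambda>x. (2 ^ n + of_nat x - 1 :: rat) gchoose x) = (1 - fps_X) powi (- (2 ^ n))"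
    using negative_binomial_series[of "2 ^ n", where 'b = rat] by simp
  have "(2 ^ n + of_nat x - 2 :: rat) = of_nat (2 ^ n - 1) + of_nat x - 1" for x
    by (simp add: of_nat_diff)
  moreover have "int (2 ^ n - 1) = 2 ^ n - 1"
    by (simp add: of_nat_diff)
  ultimately show "Abs_fps (\<lambda>x. (2 ^ n + of_nat x - 2 :: rat) gchoose x) =
      (1 - fps_X) powi (- (2 ^ n - 1))"
    using negative_binomial_series[of "2 ^ n - 1", where 'b = rat] by simp
qed

end
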